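(* Let $\Omega_{\mathbb L}=\{(f,p,\lambda):f\in\mathbb R,\ p\in[0,1],\ \lambda>0\}$. If $\ell:\Omega_{\mathbb L}\to\mathbb R$ is any subsolution, then $\ell\le\mathbb L$ on $\Omega_{\mathbb L}$.
   Context: $\mathcal D$ denotes the standard collection of dyadic intervals of $\mathbb R$. For $I\in\mathcal D$, $I_-$ and $I_+$ are its left and right halves, $\mathbf 1_I$ its indicator function, and $|E|$ denotes Lebesgue measure. For integrable $\varphi$, $\langle\varphi\rangle_I=\frac1{|I|}\int_I\varphi\,dx$. Functions are real-valued. For $J\in\mathcal D$ the (localized) dyadic square function is given by $$S_J^2\varphi(x)=\sum_{I\in\mathcal D,\ I\subseteq J}|\Delta_I\varphi|^2\,\mathbf 1_I(x),\qquad \Delta_I\varphi=\tfrac12\big(\langle\varphi\rangle_{I_+}-\langle\varphi\rangle_{I_-}\big)\big(\mathbf 1_{I_+}-\mathbf 1_{I_-}\big).$$ For $f\in\mathbb R$, $0\le p\le1$, $\lambda>0$, $$\mathbb L(f,p,\lambda)=\inf\langle|\varphi|\rangle_J,$$ the infimum being over all integrable $\varphi$ supported in $J\in\mathcal D$ with $\langle\varphi\rangle_J=f$ and $\frac1{|J|}|\{x\in J:S_J^2\varphi(x)\ge\lambda\}|=p$; it does not depend on the choice of $J$. A function $\ell(f,p,\lambda)$ on $\Omega_{\mathbb L}$ is a subsolution if it is non-negative, continuous, and satisfies: (1) the main inequality $$\ell(f,p,\lambda+a^2)\ \le\ \tfrac12\big(\ell(f+a,p+b,\lambda)+\ell(f-a,p-b,\lambda)\big)$$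 for all $f,p,\lambda,a,b$ such that the points involved lie in $\Omega_{\mathbb L}$; (2) the range/obstacle condition $|f|\le\ell(f,p,\lambda)\le\max\{|f|,\sqrt\lambda\}$; (3) the boundary condition $\ell(f,0,\lambda)=|f|$. *)

theory Defs
  imports "HOL-Analysis.Analysis"
begin

definition dyadic :: "real set set" where
  "dyadic = {{of_int k * 2 powi n ..< (of_int k + 1) * 2 powi n} | (k :: int) (n :: int). True}"

definition left_half :: "real set \<Rightarrow> real set" where
  "left_half I = {Inf I ..< (Inf I + Sup I) / 2}"

definition right_half :: "real set \<Rightarrow> real set" where
  "right_half I = {(Inf I + Sup I) / 2 ..< Sup I}"

definition avg :: "real set \<Rightarrow> (real \<Rightarrow> real) \<Rightarrow> real" where
  "avg I \<phi> = (LINT x:I|lebesgue. \<phi> x) / measure lebesgue I"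

definition martingale_diff :: "real set \<Rightarrow> (real \<Rightarrow> real) \<Rightarrow> real \<Rightarrow> real" where
  "martingale_diff I \<phi> x =
     1 / 2 * (avg (right_half I) \<phi> - avg (left_half I) \<phi>)
       * (indicator (right_half I) x - indicator (left_half I) x)"

(* The square of the localized dyadic square function. It may diverge for integrable
   functions, hence the values in [0, \<infinity>]; a real-valued infinite sum would be 0 there. *)
definition square_fun2 :: "real set \<Rightarrow> (real \<Rightarrow> real) \<Rightarrow> real \<Rightarrow> ennreal" where
  "square_fun2 J \<phi> x =
     (\<Sum>\<^sub>\<infinity>I\<in>{I \<in> dyadic. I \<subseteq> J}. ennreal (\<bar>martingale_diff I \<phi> x\<bar>\<^sup>2 * indicator I x))"

definition Omega_L :: "(real \<times> real \<times> real) set" where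
  "Omega_L = {(f, p, l). 0 \<le> p \<and> p \<le> 1 \<and> 0 < l}"

definition admissible :: "real set \<Rightarrow> real \<times> real \<times> real \<Rightarrow> (real \<Rightarrow> real) set" where
  "admissible J = (\<lambda>(f, p, l). {\<phi>.
     integrable lebesgue \<phi> \<and> (\<forall>x. x \<notin> J \<longrightarrow> \<phi> x = 0) \<and>
     avg J \<phi> = f \<and>
     measure lebesgue {x \<in> J. square_fun2 J \<phi> x \<ge> ennreal l} / measure lebesgue J = p})"

(* The interval J is kept as a parameter, so independence of J is not built in. The infimum
   is taken in the extended reals, where the infimum of the empty set is \<infinity>. *)
definition bellman_L :: "real set \<Rightarrow> real \<times> real \<times> real \<Rightarrow> ereal" where
  "bellman_L J \<omega> = (INF \<phi>\<in>admissible J \<omega>. ereal (avg J (\<lambda>x. \<bar>\<phi> x\<bar>)))"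

(* Only the values on Omega_L matter. *)
definition subsolution :: "(real \<times> real \<times> real \<Rightarrow> real) \<Rightarrow> bool" where
  "subsolution u \<longleftrightarrow>
     (\<forall>\<omega>\<in>Omega_L. 0 \<le> u \<omega>) \<and>
     continuous_on Omega_L u \<and>
     (\<forall>f p l a b. (f, p, l + a\<^sup>2) \<in> Omega_L \<and> (f + a, p + b, l) \<in> Omega_L \<and>
        (f - a, p - b, l) \<in> Omega_L \<longrightarrow>
        u (f, p, l + a\<^sup>2) \<le> 1 / 2 * (u (f + a, p + b, l) + u (f - a, p - b, l))) \<and>
     (\<forall>f p l. (f, p, l) \<in> Omega_L \<longrightarrow> \<bar>f\<bar> \<le> u (f, p, l) \<and> u (f, p, l) \<le> max \<bar>f\<bar> (sqrt l)) \<and>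
     (\<forall>f l. (f, 0, l) \<in> Omega_L \<longrightarrow> u (f, 0, l) = \<bar>f\<bar>)"

end

theory Submission
  imports Defs
begin

text \<open>
  Iterate the main inequality down the dyadic tree below \<open>J\<close>, replacing the level \<open>\<lambda>\<close> by
  \<open>\<lambda> - a\<^sup>2\<close> at each step, where \<open>2a\<close> is the jump between the averages over the two halves. On an
  interval where \<open>a\<^sup>2 \<ge> \<lambda>\<close> stop: there the obstacle condition gives
  \<open>u \<le> max \<bar>f\<bar> \<bar>a\<bar> = (\<bar>f - a\<bar> + \<bar>f + a\<bar>) / 2 \<le> \<langle>\<bar>\<phi>\<bar>\<rangle>\<close>. On the remaining intervals of generation
  \<open>n\<close>, \<open>u\<close> exceeds \<open>\<bar>f\<bar>\<close> by a gap between 0 and \<open>\<surd>\<lambda>\<close>. This gap tends to 0 almost everywhere: where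
  the square function stays below the level, Lebesgue differentiation yields \<open>f \<rightarrow> \<phi>(x)\<close> and
  \<open>p \<rightarrow> 0\<close>, so continuity and the boundary condition apply; where the level is attained in the
  limit only, the remaining level tends to 0 and the obstacle condition suffices. Dominated
  convergence removes the gap.
\<close>

section \<open>Dyadic intervals by position and scale\<close>

definition dyadic_interval :: "int \<Rightarrow> int \<Rightarrow> real set" where
  "dyadic_interval k m = {of_int k * 2 powi m ..< (of_int k + 1) * 2 powi m}"

text \<open>The floor picks the one dyadic interval of length \<open>2 powi m\<close> around
  \<open>x\<close>. Letting the scale run through \<open>m - int n\<close> turns the branch of the
  dyadic tree towards \<open>x\<close> into a sequence.\<close>

definition dyadic_cell :: "int \<Rightarrow> real \<Rightarrow> real set" where
  "dyadic_cell m x = dyadic_interval \<lfloor>x / 2 powi m\<rfloor> m"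

text \<open>On a dyadic interval \<open>I\<close> this is the \<open>a\<close> of the main
  inequality, and its absolute value is that of \<open>martingale_diff I \<phi>\<close> at every
  point of \<open>I\<close>.\<close>

definition half_jump :: "(real \<Rightarrow> real) \<Rightarrow> real set \<Rightarrow> real" where
  "half_jump \<phi> I = (avg (right_half I) \<phi> - avg (left_half I) \<phi>) / 2"

lemma powi_two_pos [simp]: "0 < (2::real) powi m"
  by (simp add: zero_less_power_int)

lemma powi_two_diff_one: "(2::real) powi (m - 1) = 2 powi m / 2"
  by (simp add: power_int_diff)

lemma powi_two_le_iff [simp]: "(2::real) powi m \<le> 2 powi n \<longleftrightarrow> m \<le> n"
  using power_int_strict_increasing[of m n "2::real"] power_int_strict_increasing[of n m "2::real"]
  by (cases m n rule: linorder_cases) auto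

lemma dyadic_iff: "I \<in> dyadic \<longleftrightarrow> (\<exists>k m. I = dyadic_interval k m)"
  unfolding dyadic_def dyadic_interval_def by blast

lemma mem_dyadic_interval_iff: "x \<in> dyadic_interval k m \<longleftrightarrow> \<lfloor>x / 2 powi m\<rfloor> = k"
  by (auto simp: dyadic_interval_def floor_eq_iff field_simps)

lemma dyadic_cell_eq: "x \<in> dyadic_interval k m \<Longrightarrow> dyadic_cell m x = dyadic_interval k m"
  by (simp add: mem_dyadic_interval_iff dyadic_cell_def)

lemma mem_dyadic_cell [simp]: "x \<in> dyadic_cell m x"
  by (simp add: mem_dyadic_interval_iff dyadic_cell_def)

lemma sets_dyadic_interval [simp, measurable]: "dyadic_interval k m \<in> sets lebesgue"
  by (simp add: dyadic_interval_def)

lemma dyadic_interval_bounds: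
  "of_int k * 2 powi m < (of_int k + 1) * (2::real) powi m"
  by simp

lemma measure_dyadic_interval [simp]: "measure lebesgue (dyadic_interval k m) = 2 powi m"
  using dyadic_interval_bounds[of k m]
  by (simp add: dyadic_interval_def algebra_simps del: mult_less_cancel_right)

lemma emeasure_dyadic_interval [simp]:
  "emeasure lebesgue (dyadic_interval k m) = ennreal (2 powi m)"
  using dyadic_interval_bounds[of k m]
  by (simp add: dyadic_interval_def algebra_simps del: mult_less_cancel_right)

lemma left_half_dyadic_interval: "left_half (dyadic_interval k m) = dyadic_interval (2 * k) (m - 1)"
  using dyadic_interval_bounds[of k m]
  by (simp add: left_half_def dyadic_interval_def powi_two_diff_one algebra_simps add_divide_distrib
      del: mult_less_cancel_right)

lemma right_half_dyadic_interval:
  "right_half (dyadic_interval k m) = dyadic_interval (2 * k + 1) (m - 1)"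
  using dyadic_interval_bounds[of k m]
  by (simp add: right_half_def dyadic_interval_def powi_two_diff_one algebra_simps add_divide_distrib
      del: mult_less_cancel_right)

lemma dyadic_interval_halves:
  "dyadic_interval k m = dyadic_interval (2 * k) (m - 1) \<union> dyadic_interval (2 * k + 1) (m - 1)"
  "dyadic_interval (2 * k) (m - 1) \<inter> dyadic_interval (2 * k + 1) (m - 1) = {}"
proof -
  have "0 < (2::real) powi m" by simp
  then show "dyadic_interval k m = dyadic_interval (2 * k) (m - 1) \<union> dyadic_interval (2 * k + 1) (m - 1)"
    unfolding dyadic_interval_def powi_two_diff_one by (auto simp: algebra_simps)
  show "dyadic_interval (2 * k) (m - 1) \<inter> dyadic_interval (2 * k + 1) (m - 1) = {}"
    by (auto simp: mem_dyadic_interval_iff)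
qed

text \<open>One halving per induction step: the half that contains \<open>x\<close> is the next
  cell.\<close>

lemma dyadic_cell_diff_subset: "dyadic_cell (m - int n) x \<subseteq> dyadic_cell m x"
proof (induction n)
  case (Suc n)
  let ?k = "\<lfloor>x / 2 powi (m - int n)\<rfloor>" and ?m = "m - int n"
  have eq: "dyadic_cell ?m x = dyadic_interval (2 * ?k) (?m - 1) \<union> dyadic_interval (2 * ?k + 1) (?m - 1)"
    unfolding dyadic_cell_def by (rule dyadic_interval_halves)
  have "x \<in> dyadic_cell ?m x" by simp
  with eq have "x \<in> dyadic_interval (2 * ?k) (?m - 1) \<or> x \<in> dyadic_interval (2 * ?k + 1) (?m - 1)"
    by simp
  then have "dyadic_cell (?m - 1) x \<subseteq> dyadic_cell ?m x"
    using eq dyadic_cell_eq by blast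
  then show ?case using Suc by (simp add: algebra_simps)
qed simp

lemma dyadic_interval_subset_scale:
  assumes "dyadic_interval k n \<subseteq> dyadic_interval l m"
  shows "n \<le> m"
proof -
  have "measure lebesgue (dyadic_interval k n) \<le> measure lebesgue (dyadic_interval l m)"
    by (rule measure_mono_fmeasurable) (use assms in \<open>auto simp: fmeasurable_def\<close>)
  then show ?thesis by simp
qed

section \<open>The square function as a series along a branch\<close>

lemma square_fun2_eq_suminf:
  assumes x: "x \<in> dyadic_interval k m"
  shows "square_fun2 (dyadic_interval k m) \<phi> x =
    (\<Sum>n. ennreal ((half_jump \<phi> (dyadic_cell (m - int n) x))\<^sup>2))"
proof -
  define c where "c = (\<lambda>n. dyadic_cell (m - int n) x)"
  let ?T = "\<lambda>I. ennreal (\<bar>martingale_diff I \<phi> x\<bar>\<^sup>2 * indicator I x)"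
  have inj: "inj c"
  proof
    fix i j assume "c i = c j"
    then have "measure lebesgue (c i) = measure lebesgue (c j)" by simp
    then have "(2::real) powi (m - int i) = 2 powi (m - int j)" by (simp add: c_def dyadic_cell_def)
    then have "m - int i = m - int j" by (metis order_antisym order_refl powi_two_le_iff)
    then show "i = j" by simp
  qed
  \<comment> \<open>Intervals without \<open>x\<close> contribute 0, and a dyadic subinterval of
    scale \<open>j\<close> containing \<open>x\<close> is the cell \<open>c (nat (m - j))\<close>.
    So only the range of \<open>c\<close> matters, and no term is counted twice because the cells
    have different lengths.\<close>
  have "square_fun2 (dyadic_interval k m) \<phi> x = infsum ?T (range c)"
    unfolding square_fun2_def
  proof (rule infsum_cong_neutral)
    fix I assume "I \<in> range c - {I \<in> dyadic. I \<subseteq> dyadic_interval k m}"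
    then obtain n where n: "I = c n" "\<not> (I \<in> dyadic \<and> I \<subseteq> dyadic_interval k m)" by blast
    have "c n \<in> dyadic" by (auto simp: dyadic_iff c_def dyadic_cell_def)
    moreover have "c n \<subseteq> dyadic_interval k m"
      using dyadic_cell_diff_subset[of m n x] dyadic_cell_eq[OF x] by (simp add: c_def)
    ultimately show "?T I = 0" using n by blast
  next
    fix I assume I: "I \<in> {I \<in> dyadic. I \<subseteq> dyadic_interval k m} - range c"
    then obtain l j where lj: "I = dyadic_interval l j" by (auto simp: dyadic_iff)
    then have "j \<le> m" using I dyadic_interval_subset_scale by auto
    have "x \<notin> I"
    proof
      assume "x \<in> I"
      then have "dyadic_cell j x = I" using lj dyadic_cell_eq by simp
      then have "I = c (nat (m - j))" using \<open>j \<le> m\<close> by (simp add: c_def)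
      then show False using I by blast
    qed
    then show "?T I = 0" by simp
  qed simp
  also have "\<dots> = infsum (?T \<circ> c) UNIV"
    using inj by (rule infsum_reindex)
  also have "?T \<circ> c = (\<lambda>n. ennreal ((half_jump \<phi> (c n))\<^sup>2))"
  proof
    fix n
    obtain l j where lj: "c n = dyadic_interval l j" by (auto simp: c_def dyadic_cell_def)
    have "x \<in> c n" by (simp add: c_def)
    \<comment> \<open>\<open>x\<close> lies in exactly one of the two halves, so the difference of
      the indicators is 1 or -1.\<close>
    then have "\<bar>martingale_diff (c n) \<phi> x\<bar> = \<bar>half_jump \<phi> (c n)\<bar>"
      using dyadic_interval_halves[of l j]
      unfolding lj martingale_diff_def half_jump_def left_half_dyadic_interval right_half_dyadic_interval
      by (auto simp: indicator_def)
    then show "(?T \<circ> c) n = ennreal ((half_jump \<phi> (c n))\<^sup>2)"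
      using \<open>x \<in> c n\<close> by (simp add: abs_eq_iff power2_eq_iff)
  qed
  \<comment> \<open>Every family in \<open>ennreal\<close> is summable, so the unordered sum agrees
    with the series.\<close>
  also have "infsum \<dots> UNIV = (\<Sum>n. ennreal ((half_jump \<phi> (c n))\<^sup>2))"
    by (intro sums_unique has_sum_imp_sums has_sum_infsum nonneg_summable_on_complete)
      simp
  finally show ?thesis by (simp add: c_def)
qed

text \<open>\<open>F\<close> sees \<open>x\<close> only through the integer index of the cell, and
  every map out of \<open>count_space UNIV\<close> is measurable.\<close>

lemma borel_measurable_dyadic_cell:
  fixes F :: "real set \<Rightarrow> 'b :: topological_space"
  shows "(\<lambda>x. F (dyadic_cell m x)) \<in> borel_measurable borel"
proof -
  have [measurable]: "(\<lambda>x::real. \<lfloor>x / 2 powi m\<rfloor>) \<in> borel \<rightarrow>\<^sub>M count_space UNIV"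
    by (rule measurable_compose[of "\<lambda>x. x / 2 powi m" _ borel]) simp_all
  have "(\<lambda>x::real. F (dyadic_interval \<lfloor>x / 2 powi m\<rfloor> m)) \<in> borel_measurable borel"
    by (rule measurable_compose[where f = "\<lambda>x::real. \<lfloor>x / 2 powi m\<rfloor>" and N = "count_space UNIV"]) simp_all
  then show ?thesis by (simp add: dyadic_cell_def)
qed

text \<open>Needed to add the measures of such sets over two halves, and to apply the
  differentiation theorem to their indicators.\<close>

lemma lmeasurable_square_fun2_ge:
  "{x \<in> dyadic_interval k m. square_fun2 (dyadic_interval k m) \<phi> x \<ge> c} \<in> lmeasurable"
proof -
  define S where "S = (\<lambda>x. \<Sum>n. ennreal ((half_jump \<phi> (dyadic_cell (m - int n) x))\<^sup>2))"
  have "S \<in> borel_measurable borel"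
    unfolding S_def by (intro borel_measurable_suminf_order borel_measurable_dyadic_cell)
  then have "S \<in> borel_measurable lebesgue"
    by (intro measurable_completion) simp
  then have "{x \<in> space lebesgue. c \<le> S x} \<in> sets lebesgue" by measurable
  then have "dyadic_interval k m \<inter> {x. c \<le> S x} \<in> sets lebesgue"
    by (intro sets.Int) auto
  moreover have "dyadic_interval k m \<inter> {x. c \<le> S x} =
    {x \<in> dyadic_interval k m. square_fun2 (dyadic_interval k m) \<phi> x \<ge> c}"
    by (auto simp: S_def square_fun2_eq_suminf)
  ultimately have "{x \<in> dyadic_interval k m. square_fun2 (dyadic_interval k m) \<phi> x \<ge> c} \<in> sets lebesgue"
    by simp
  moreover have "dyadic_interval k m \<in> lmeasurable" by (auto simp: fmeasurable_def)
  ultimately show ?thesis by (rule fmeasurableI2[rotated 2]) auto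
qed

text \<open>The term of index 0 belongs to the parent interval; the remaining terms run along the
  same branch, started at the half that contains \<open>x\<close>.\<close>

lemma square_fun2_dyadic_half:
  assumes h: "k' = 2 * k \<or> k' = 2 * k + 1" and x: "x \<in> dyadic_interval k' (m - 1)"
  shows "square_fun2 (dyadic_interval k m) \<phi> x =
    ennreal ((half_jump \<phi> (dyadic_interval k m))\<^sup>2) + square_fun2 (dyadic_interval k' (m - 1)) \<phi> x"
proof -
  let ?s = "\<lambda>n. ennreal ((half_jump \<phi> (dyadic_cell (m - int n) x))\<^sup>2)"
  have xk: "x \<in> dyadic_interval k m" using h x dyadic_interval_halves(1)[of k m] by auto
  have "square_fun2 (dyadic_interval k m) \<phi> x = (\<Sum>n. ?s n)"
    using xk by (rule square_fun2_eq_suminf)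
  also have "\<dots> = ?s 0 + (\<Sum>n. ?s (Suc n))"
    by (rule sums_unique[symmetric], subst add.commute)
      (rule sums_Suc[OF summable_sums], simp)
  also have "(\<Sum>n. ?s (Suc n)) = square_fun2 (dyadic_interval k' (m - 1)) \<phi> x"
    by (subst square_fun2_eq_suminf[OF x]) (simp add: algebra_simps)
  finally show ?thesis using dyadic_cell_eq[OF xk] by simp
qed

section \<open>Lebesgue differentiation along dyadic cells\<close>

lemma avg_atLeastLessThan:
  assumes f: "integrable lebesgue f" and "a < b"
  shows "avg {a..<b} f = integral {a..b} f / (b - a)"
proof -
  have "set_integrable lebesgue {a..<b} f"
    unfolding set_integrable_def using integrable_mult_indicator[OF _ f] by simp
  then have "(LINT x:{a..<b}|lebesgue. f x) = integral {a..<b} f"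
    by (rule set_lebesgue_integral_eq_integral)
  also have "\<dots> = integral {a..b} f"
    by (rule integral_spike_set; rule negligible_subset[of "{b}"]) auto
  finally show ?thesis using \<open>a < b\<close> by (simp add: avg_def)
qed

text \<open>The differentiation theorem for intervals starting at \<open>x\<close> is applied to
  \<open>f\<close> and to its reflection, which covers intervals ending at \<open>x\<close>. The
  average over an interval around \<open>x\<close> is a convex combination of the averages to the
  left and to the right of \<open>x\<close>.\<close>

lemma AE_averages_close:
  fixes f :: "real \<Rightarrow> real"
  assumes f: "integrable lebesgue f"
  shows "AE x in lebesgue. \<forall>e>0. \<exists>d>0. \<forall>a b. a \<le> x \<and> x < b \<and> b - a < d \<longrightarrow>
    \<bar>avg {a..<b} f - f x\<bar> < e"
proof -
  have int: "f integrable_on {a..b}" for a b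
  proof -
    have "set_integrable lebesgue {a..b} f"
      unfolding set_integrable_def using integrable_mult_indicator[OF _ f] by simp
    then show ?thesis by (rule set_lebesgue_integral_eq_integral)
  qed
  have int': "(\<lambda>x. f (- x)) integrable_on {a..b}" for a b
    using Henstock_Kurzweil_Integration.integrable_reflect_real[where f = f and a = "-b" and b = "-a"]
      int[of "-b" "-a"] by simp
  obtain N where N: "negligible N" and right: "\<And>x e. \<lbrakk>x \<notin> N; 0 < e\<rbrakk> \<Longrightarrow>
      \<exists>d>0. \<forall>h. 0 < h \<and> h < d \<longrightarrow> \<bar>integral {x..x + h} f / h - f x\<bar> < e"
  proof -
    have "f integrable_on cbox a b" for a b using int by simp
    from integrable_ccontinuous_explicit[OF this] that show thesis
      by (auto simp: field_simps)
  qed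
  obtain N' where N': "negligible N'" and left: "\<And>x e. \<lbrakk>x \<notin> N'; 0 < e\<rbrakk> \<Longrightarrow>
      \<exists>d>0. \<forall>h. 0 < h \<and> h < d \<longrightarrow> \<bar>integral {x..x + h} (\<lambda>x. f (- x)) / h - f (- x)\<bar> < e"
  proof -
    have "(\<lambda>x. f (- x)) integrable_on cbox a b" for a b using int' by simp
    from integrable_ccontinuous_explicit[OF this] that show thesis
      by (auto simp: field_simps)
  qed
  have "negligible (N \<union> uminus ` N')"
    using N N' by (intro negligible_Un negligible_differentiable_image_negligible)
      (auto intro: derivative_intros)
  then have "AE x in lebesgue. x \<notin> N \<union> uminus ` N'"
    by (intro AE_not_in) (simp add: negligible_iff_null_sets)
  then show ?thesis
  proof (rule AE_mp, intro AE_I2 impI allI)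
    fix x e :: real assume "x \<notin> N \<union> uminus ` N'" and e: "0 < e"
    then have x: "x \<notin> N" "- x \<notin> N'" by (auto intro: image_eqI[of _ _ "-x"])
    obtain d where d: "d > 0" "\<And>h. 0 < h \<Longrightarrow> h < d \<Longrightarrow> \<bar>integral {x..x + h} f / h - f x\<bar> < e"
      using right[OF x(1) e] by blast
    obtain d' where d': "d' > 0"
      "\<And>h. 0 < h \<Longrightarrow> h < d' \<Longrightarrow> \<bar>integral {-x..-x + h} (\<lambda>x. f (- x)) / h - f x\<bar> < e"
      using left[OF x(2) e] by auto
    show "\<exists>d>0. \<forall>a b. a \<le> x \<and> x < b \<and> b - a < d \<longrightarrow> \<bar>avg {a..<b} f - f x\<bar> < e"
    proof (intro exI[of _ "min d d'"] conjI allI impI)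
      fix a b assume ab: "a \<le> x \<and> x < b \<and> b - a < min d d'"
      have R: "\<bar>integral {x..b} f - (b - x) * f x\<bar> < e * (b - x)"
      proof -
        have "\<bar>integral {x..b} f / (b - x) - f x\<bar> < e"
          using d(2)[of "b - x"] ab by simp
        moreover have "integral {x..b} f - (b - x) * f x = (integral {x..b} f / (b - x) - f x) * (b - x)"
          using ab by (simp add: field_simps)
        ultimately show ?thesis using ab by (simp add: abs_mult)
      qed
      \<comment> \<open>\<open>x\<close> may be the left endpoint, so this bound is not strict;
        since \<open>x < b\<close>, the strict bound \<open>R\<close> keeps the sum of both
        strict.\<close>
      have L: "\<bar>integral {a..x} f - (x - a) * f x\<bar> \<le> e * (x - a)"
      proof (cases "a = x")
        case False
        have "integral {-x..-a} (\<lambda>x. f (- x)) = integral {a..x} f"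
          by (rule Henstock_Kurzweil_Integration.integral_reflect_real)
        then have "\<bar>integral {a..x} f / (x - a) - f x\<bar> < e"
          using d'(2)[of "x - a"] ab False by simp
        moreover have "integral {a..x} f - (x - a) * f x = (integral {a..x} f / (x - a) - f x) * (x - a)"
          using ab False by (simp add: field_simps)
        ultimately show ?thesis using ab by (simp add: abs_mult mult_right_mono)
      qed simp
      have "integral {a..b} f = integral {a..x} f + integral {x..b} f"
        using ab int[of a b] by (intro Henstock_Kurzweil_Integration.integral_combine[symmetric]) auto
      moreover have "(b - a) * f x = (x - a) * f x + (b - x) * f x" by (simp add: algebra_simps)
      moreover have "e * (b - a) = e * (x - a) + e * (b - x)" by (simp add: algebra_simps)
      ultimately have "\<bar>integral {a..b} f - (b - a) * f x\<bar> < e * (b - a)"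
        using L R by linarith
      moreover have "integral {a..b} f / (b - a) - f x = (integral {a..b} f - (b - a) * f x) / (b - a)"
        using ab by (simp add: field_simps)
      ultimately show "\<bar>avg {a..<b} f - f x\<bar> < e"
        using ab avg_atLeastLessThan[OF f, of a b] by (simp add: pos_divide_less_eq flip: abs_div_pos)
    qed (use d d' in simp)
  qed
qed

text \<open>The position of \<open>x\<close> inside its cells is arbitrary, but their lengths
  \<open>2 powi m * (1 / 2) ^ n\<close> tend to 0, which is all that
  \<open>AE_averages_close\<close> asks for.\<close>

lemma AE_avg_dyadic_cell_tendsto:
  assumes f: "integrable lebesgue f"
  shows "AE x in lebesgue. (\<lambda>n. avg (dyadic_cell (m - int n) x) f) \<longlonglongrightarrow> f x"
  using AE_averages_close[OF f]
proof (rule AE_mp, intro AE_I2 impI)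
  fix x assume *: "\<forall>e>0. \<exists>d>0. \<forall>a b. a \<le> x \<and> x < b \<and> b - a < d \<longrightarrow> \<bar>avg {a..<b} f - f x\<bar> < e"
  show "(\<lambda>n. avg (dyadic_cell (m - int n) x) f) \<longlonglongrightarrow> f x"
  proof (rule LIMSEQ_I)
    fix e :: real assume "0 < e"
    obtain d where d: "d > 0"
      "\<forall>a b. a \<le> x \<and> x < b \<and> b - a < d \<longrightarrow> \<bar>avg {a..<b} f - f x\<bar> < e"
      using *[rule_format, OF \<open>0 < e\<close>] by (elim exE conjE)
    have "(\<lambda>n. 2 powi m * (1 / 2) ^ n :: real) \<longlonglongrightarrow> 2 powi m * 0"
      by (intro tendsto_mult tendsto_const LIMSEQ_realpow_zero) simp_all
    then have "\<forall>\<^sub>F n in sequentially. 2 powi m * (1 / 2) ^ n < d"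
      using d(1) by (intro order_tendstoD(2)) auto
    then obtain N where N: "\<And>n. n \<ge> N \<Longrightarrow> 2 powi m * (1 / 2) ^ n < d"
      by (auto simp: eventually_sequentially)
    have "norm (avg (dyadic_cell (m - int n) x) f - f x) < e" if "n \<ge> N" for n
    proof -
      let ?m = "m - int n" and ?k = "\<lfloor>x / 2 powi (m - int n)\<rfloor>"
      have "(2::real) powi ?m = 2 powi m * (1 / 2) ^ n"
        by (simp add: power_int_diff power_one_over field_simps)
      then have "2 powi ?m < d" using N[OF that] by simp
      moreover have "x \<in> dyadic_interval ?k ?m" by (simp add: mem_dyadic_interval_iff)
      ultimately show ?thesis
        using d(2)[rule_format, of "of_int ?k * 2 powi ?m" "(of_int ?k + 1) * 2 powi ?m"]
        by (simp add: dyadic_cell_def dyadic_interval_def algebra_simps)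
    qed
    then show "\<exists>N. \<forall>n\<ge>N. norm (avg (dyadic_cell (m - int n) x) f - f x) < e" by blast
  qed
qed

section \<open>The parameters of the subsolution along a branch\<close>

definition exceed_ratio :: "(real \<Rightarrow> real) \<Rightarrow> real \<Rightarrow> real set \<Rightarrow> real" where
  "exceed_ratio \<phi> l I =
    measure lebesgue {x \<in> I. square_fun2 I \<phi> x \<ge> ennreal l} / measure lebesgue I"

text \<open>The level left for the cell of generation \<open>n\<close>: the jumps of generations
  below \<open>n\<close> are already subtracted, the jump on that cell itself is not.\<close>

definition residual_level :: "(real \<Rightarrow> real) \<Rightarrow> int \<Rightarrow> real \<Rightarrow> nat \<Rightarrow> real \<Rightarrow> real" where
  "residual_level \<phi> m l n x = l - (\<Sum>i<n. (half_jump \<phi> (dyadic_cell (m - int i) x))\<^sup>2)"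

text \<open>Once the level is no longer positive the triple has left \<^const>\<open>Omega_L\<close>, so the gap is set
  to 0.\<close>

definition subsol_gap ::
  "(real \<times> real \<times> real \<Rightarrow> real) \<Rightarrow> (real \<Rightarrow> real) \<Rightarrow> int \<Rightarrow> real \<Rightarrow> nat \<Rightarrow> real \<Rightarrow> real" where
  "subsol_gap u \<phi> m l n x =
    (let I = dyadic_cell (m - int n) x; r = residual_level \<phi> m l n x
     in if 0 < r then u (avg I \<phi>, exceed_ratio \<phi> r I, r) - \<bar>avg I \<phi>\<bar> else 0)"

lemma residual_level_0 [simp]: "residual_level \<phi> m l 0 x = l"
  by (simp add: residual_level_def)

text \<open>Splitting off the first jump rather than the last suits inductions that pass from an
  interval to its halves.\<close>

lemma residual_level_Suc:
  "residual_level \<phi> m l (Suc n) x =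
    residual_level \<phi> (m - 1) (l - (half_jump \<phi> (dyadic_cell m x))\<^sup>2) n x"
  unfolding residual_level_def sum.lessThan_Suc_shift by (simp add: algebra_simps)

lemma residual_level_antimono: "i \<le> n \<Longrightarrow> residual_level \<phi> m l n x \<le> residual_level \<phi> m l i x"
  unfolding residual_level_def by (auto intro!: sum_mono2)

lemma residual_level_le: "residual_level \<phi> m l n x \<le> l"
  using residual_level_antimono[of 0 n] by simp

lemma subsol_gap_Suc:
  "subsol_gap u \<phi> m l (Suc n) x =
    subsol_gap u \<phi> (m - 1) (l - (half_jump \<phi> (dyadic_cell m x))\<^sup>2) n x"
  by (simp add: subsol_gap_def residual_level_Suc algebra_simps)

lemma ennreal_le_add_iff:
  assumes "0 \<le> c" "c \<le> l"
  shows "ennreal l \<le> ennreal c + s \<longleftrightarrow> ennreal (l - c) \<le> s"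
proof -
  have "ennreal l = ennreal c + ennreal (l - c)"
    using assms by (simp flip: ennreal_plus)
  then show ?thesis by (simp add: ennreal_add_left_cancel_le)
qed

text \<open>Each halving removes the same finite term from both sides. Hence the exceptional set of
  every descendant with positive level is the trace of one fixed set, so its
  \<open>exceed_ratio\<close> is a density of that set.\<close>

lemma square_fun2_ge_residual_iff:
  assumes "x \<in> dyadic_interval k m" "0 < residual_level \<phi> m l n x" "y \<in> dyadic_cell (m - int n) x"
  shows "ennreal (residual_level \<phi> m l n x) \<le> square_fun2 (dyadic_cell (m - int n) x) \<phi> y \<longleftrightarrow>
    ennreal l \<le> square_fun2 (dyadic_interval k m) \<phi> y"
  using assms
proof (induction n arbitrary: k m l)
  case 0
  then show ?case by (simp add: dyadic_cell_eq)
next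
  case (Suc n)
  define a where "a = half_jump \<phi> (dyadic_interval k m)"
  obtain k' where k': "k' = 2 * k \<or> k' = 2 * k + 1" "x \<in> dyadic_interval k' (m - 1)"
    using Suc.prems(1) dyadic_interval_halves(1)[of k m] by blast
  have res: "residual_level \<phi> m l (Suc n) x = residual_level \<phi> (m - 1) (l - a\<^sup>2) n x"
    using Suc.prems(1) by (simp add: residual_level_Suc a_def dyadic_cell_eq)
  have cell: "dyadic_cell (m - int (Suc n)) x = dyadic_cell (m - 1 - int n) x"
    by (simp add: algebra_simps)
  have "y \<in> dyadic_interval k' (m - 1)"
    using Suc.prems(3) dyadic_cell_diff_subset[of "m - 1" n x] dyadic_cell_eq[OF k'(2)] cell by auto
  then have step: "square_fun2 (dyadic_interval k m) \<phi> y =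
      ennreal (a\<^sup>2) + square_fun2 (dyadic_interval k' (m - 1)) \<phi> y"
    unfolding a_def by (rule square_fun2_dyadic_half[OF k'(1)])
  \<comment> \<open>Residual levels only decrease down the branch, so the positive level at the end
    forces this earlier one to be positive.\<close>
  have "0 < l - a\<^sup>2"
    using Suc.prems(2) residual_level_le[of \<phi> "m - 1" "l - a\<^sup>2" n x] res by linarith
  then have "ennreal l \<le> square_fun2 (dyadic_interval k m) \<phi> y \<longleftrightarrow>
      ennreal (l - a\<^sup>2) \<le> square_fun2 (dyadic_interval k' (m - 1)) \<phi> y"
    unfolding step by (intro ennreal_le_add_iff) auto
  then show ?case
    using Suc.IH[OF k'(2), of "l - a\<^sup>2"] Suc.prems(2,3) unfolding res cell by simp
qed

lemma exceed_ratio_bounds: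
  "0 \<le> exceed_ratio \<phi> l (dyadic_interval k m)" "exceed_ratio \<phi> l (dyadic_interval k m) \<le> 1"
proof -
  have "measure lebesgue {x \<in> dyadic_interval k m. square_fun2 (dyadic_interval k m) \<phi> x \<ge> ennreal l}
      \<le> measure lebesgue (dyadic_interval k m)"
    by (rule measure_mono_fmeasurable)
      (use lmeasurable_square_fun2_ge[of k m "ennreal l" \<phi>] in \<open>auto simp: fmeasurable_def\<close>)
  then show "0 \<le> exceed_ratio \<phi> l (dyadic_interval k m)" "exceed_ratio \<phi> l (dyadic_interval k m) \<le> 1"
    by (simp_all add: exceed_ratio_def)
qed

text \<open>On both halves the jump uses up \<open>a\<^sup>2\<close> of the level. The halves have
  equal length, so the ratio is the midpoint of the two ratios, as the main inequality requires of
  \<open>p\<close>.\<close>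

lemma exceed_ratio_halves:
  assumes a: "a = half_jump \<phi> (dyadic_interval k m)" and l: "a\<^sup>2 \<le> l"
  shows "exceed_ratio \<phi> l (dyadic_interval k m) =
    (exceed_ratio \<phi> (l - a\<^sup>2) (dyadic_interval (2 * k) (m - 1)) +
     exceed_ratio \<phi> (l - a\<^sup>2) (dyadic_interval (2 * k + 1) (m - 1))) / 2"
proof -
  let ?E = "\<lambda>l k m. {x \<in> dyadic_interval k m. square_fun2 (dyadic_interval k m) \<phi> x \<ge> ennreal l}"
  have half: "ennreal l \<le> square_fun2 (dyadic_interval k m) \<phi> x \<longleftrightarrow>
      ennreal (l - a\<^sup>2) \<le> square_fun2 (dyadic_interval k' (m - 1)) \<phi> x"
    if "k' = 2 * k \<or> k' = 2 * k + 1" "x \<in> dyadic_interval k' (m - 1)" for k' x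
    using square_fun2_dyadic_half[OF that, of \<phi>] l a by (simp add: ennreal_le_add_iff)
  have "?E l k m = ?E (l - a\<^sup>2) (2 * k) (m - 1) \<union> ?E (l - a\<^sup>2) (2 * k + 1) (m - 1)"
    using dyadic_interval_halves(1)[of k m] half by blast
  moreover have "?E (l - a\<^sup>2) (2 * k) (m - 1) \<inter> ?E (l - a\<^sup>2) (2 * k + 1) (m - 1) = {}"
    using dyadic_interval_halves(2)[of k m] by blast
  ultimately have "measure lebesgue (?E l k m) =
      measure lebesgue (?E (l - a\<^sup>2) (2 * k) (m - 1)) + measure lebesgue (?E (l - a\<^sup>2) (2 * k + 1) (m - 1))"
    using lmeasurable_square_fun2_ge by (simp add: measure_Un3)
  then show ?thesis by (simp add: exceed_ratio_def powi_two_diff_one field_simps)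
qed

section \<open>Splitting averages and integrals over halves\<close>

lemma set_integrable_dyadic_interval:
  fixes f :: "real \<Rightarrow> real"
  shows "integrable lebesgue f \<Longrightarrow> set_integrable lebesgue (dyadic_interval k m) f"
  unfolding set_integrable_def by (rule integrable_mult_indicator) simp

lemma set_integral_dyadic_halves:
  fixes f :: "real \<Rightarrow> real"
  assumes "set_integrable lebesgue (dyadic_interval (2 * k) (m - 1)) f"
    "set_integrable lebesgue (dyadic_interval (2 * k + 1) (m - 1)) f"
  shows "(LINT x:dyadic_interval k m|lebesgue. f x) =
    (LINT x:dyadic_interval (2 * k) (m - 1)|lebesgue. f x) +
    (LINT x:dyadic_interval (2 * k + 1) (m - 1)|lebesgue. f x)"
  using set_integral_Un[OF dyadic_interval_halves(2) assms] dyadic_interval_halves(1)[of k m] by simp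

text \<open>The average over the interval is the midpoint of those over its halves, and
  \<open>half_jump\<close> is half their difference, right minus left; hence the signs.\<close>

lemma avg_halves:
  assumes \<phi>: "integrable lebesgue \<phi>" and a: "a = half_jump \<phi> (dyadic_interval k m)"
  shows "avg (dyadic_interval (2 * k) (m - 1)) \<phi> = avg (dyadic_interval k m) \<phi> - a"
    "avg (dyadic_interval (2 * k + 1) (m - 1)) \<phi> = avg (dyadic_interval k m) \<phi> + a"
proof -
  have "avg (dyadic_interval k m) \<phi> =
    (avg (dyadic_interval (2 * k) (m - 1)) \<phi> + avg (dyadic_interval (2 * k + 1) (m - 1)) \<phi>) / 2"
    using set_integral_dyadic_halves[of k m \<phi>] set_integrable_dyadic_interval[OF \<phi>]
    by (simp add: avg_def powi_two_diff_one field_simps)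
  then show "avg (dyadic_interval (2 * k) (m - 1)) \<phi> = avg (dyadic_interval k m) \<phi> - a"
    "avg (dyadic_interval (2 * k + 1) (m - 1)) \<phi> = avg (dyadic_interval k m) \<phi> + a"
    using a by (simp_all add: half_jump_def left_half_dyadic_interval right_half_dyadic_interval field_simps)
qed

lemma abs_avg_le:
  assumes \<phi>: "integrable lebesgue \<phi>"
  shows "2 powi m * \<bar>avg (dyadic_interval k m) \<phi>\<bar> \<le> (LINT x:dyadic_interval k m|lebesgue. \<bar>\<phi> x\<bar>)"
proof -
  have "\<bar>LINT x:dyadic_interval k m|lebesgue. \<phi> x\<bar> \<le> (LINT x:dyadic_interval k m|lebesgue. \<bar>\<phi> x\<bar>)"
    using integral_abs_bound[of lebesgue "\<lambda>x. indicator (dyadic_interval k m) x *\<^sub>R \<phi> x"]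
    by (simp add: set_lebesgue_integral_def abs_mult)
  then show ?thesis by (simp add: avg_def abs_mult)
qed

text \<open>Turns the obstacle bound on a stopped interval into averages over its two
  halves.\<close>

lemma max_abs_eq_half_sum: "max \<bar>f\<bar> \<bar>a\<bar> = (\<bar>f - a\<bar> + \<bar>f + a\<bar>) / (2::real)"
  by (auto simp: max_def abs_if)

text \<open>The gap is constant on each of the finitely many cells of generation \<open>n\<close>;
  the induction glues the halves together.\<close>

lemma set_integrable_subsol_gap:
  "set_integrable lebesgue (dyadic_interval k m) (subsol_gap u \<phi> m l n)"
proof (induction n arbitrary: k m l)
  case 0
  let ?I = "dyadic_interval k m"
  define c where "c = (if 0 < l then u (avg ?I \<phi>, exceed_ratio \<phi> l ?I, l) - \<bar>avg ?I \<phi>\<bar> else 0)"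
  have "set_integrable lebesgue ?I (\<lambda>_. c)"
    by (simp add: set_integrable_def)
  also have "set_integrable lebesgue ?I (\<lambda>_. c) \<longleftrightarrow> set_integrable lebesgue ?I (subsol_gap u \<phi> m l 0)"
    by (rule set_integrable_cong) (simp_all add: subsol_gap_def Let_def c_def dyadic_cell_eq)
  finally show ?case .
next
  case (Suc n)
  have half: "set_integrable lebesgue (dyadic_interval k' (m - 1)) (subsol_gap u \<phi> m l (Suc n))"
    if "k' = 2 * k \<or> k' = 2 * k + 1" for k'
  proof -
    let ?I = "dyadic_interval k' (m - 1)"
    have "subsol_gap u \<phi> m l (Suc n) x =
        subsol_gap u \<phi> (m - 1) (l - (half_jump \<phi> (dyadic_interval k m))\<^sup>2) n x" if "x \<in> ?I" for x
    proof -
      have "x \<in> dyadic_interval k m"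
        using that \<open>k' = 2 * k \<or> k' = 2 * k + 1\<close> dyadic_interval_halves(1)[of k m] by blast
      then show ?thesis by (simp add: subsol_gap_Suc dyadic_cell_eq)
    qed
    then have "set_integrable lebesgue ?I (subsol_gap u \<phi> m l (Suc n)) \<longleftrightarrow> set_integrable lebesgue ?I
        (subsol_gap u \<phi> (m - 1) (l - (half_jump \<phi> (dyadic_interval k m))\<^sup>2) n)"
      by (intro set_integrable_cong) simp_all
    then show ?thesis using Suc by blast
  qed
  have "set_integrable lebesgue (dyadic_interval (2 * k) (m - 1) \<union> dyadic_interval (2 * k + 1) (m - 1))
      (subsol_gap u \<phi> m l (Suc n))"
    by (intro set_integrable_Un half) auto
  then show ?case using dyadic_interval_halves(1)[of k m] by simp
qed

section \<open>Iteration of the main inequality for a subsolution\<close>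

context
  fixes u :: "real \<times> real \<times> real \<Rightarrow> real"
  assumes sub: "subsolution u"
begin

lemma subsolution_bounds:
  assumes "0 \<le> p" "p \<le> 1" "0 < l"
  shows "\<bar>f\<bar> \<le> u (f, p, l)" "u (f, p, l) \<le> max \<bar>f\<bar> (sqrt l)"
  using sub assms unfolding subsolution_def Omega_L_def by auto

lemma subsolution_main_ineq:
  assumes "0 \<le> p + b" "p + b \<le> 1" "0 \<le> p - b" "p - b \<le> 1" "0 < l"
  shows "u (f, p, l + a\<^sup>2) \<le> (u (f + a, p + b, l) + u (f - a, p - b, l)) / 2"
proof -
  have "0 < l + a\<^sup>2" using assms(5) by (simp add: add_pos_nonneg)
  moreover have "0 \<le> p" "p \<le> 1" using assms by linarith+
  ultimately have "(f, p, l + a\<^sup>2) \<in> Omega_L \<and> (f + a, p + b, l) \<in> Omega_L \<and> (f - a, p - b, l) \<in> Omega_L"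
    using assms by (simp add: Omega_L_def)
  then have "u (f, p, l + a\<^sup>2) \<le> 1 / 2 * (u (f + a, p + b, l) + u (f - a, p - b, l))"
    using sub unfolding subsolution_def by blast
  then show ?thesis by simp
qed

text \<open>Both bounds come from the range condition, the upper one through max \<le> sum.
  Truncating the level at 0 makes the root vanish where the gap is 0 by convention.\<close>

lemma subsol_gap_bounds:
  "0 \<le> subsol_gap u \<phi> m l n x"
  "subsol_gap u \<phi> m l n x \<le> sqrt (max 0 (residual_level \<phi> m l n x))"
proof -
  define r where "r = residual_level \<phi> m l n x"
  define I where "I = dyadic_cell (m - int n) x"
  have p: "0 \<le> exceed_ratio \<phi> r I" "exceed_ratio \<phi> r I \<le> 1"
    by (simp_all add: I_def dyadic_cell_def exceed_ratio_bounds)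
  have gap: "subsol_gap u \<phi> m l n x =
      (if 0 < r then u (avg I \<phi>, exceed_ratio \<phi> r I, r) - \<bar>avg I \<phi>\<bar> else 0)"
    by (simp add: subsol_gap_def r_def I_def Let_def)
  show "0 \<le> subsol_gap u \<phi> m l n x"
    using subsolution_bounds(1)[OF p, of r "avg I \<phi>"] by (simp add: gap)
  show "subsol_gap u \<phi> m l n x \<le> sqrt (max 0 (residual_level \<phi> m l n x))"
  proof (cases "0 < r")
    case True
    then have "max \<bar>avg I \<phi>\<bar> (sqrt r) \<le> \<bar>avg I \<phi>\<bar> + sqrt r" by simp
    then have "u (avg I \<phi>, exceed_ratio \<phi> r I, r) \<le> \<bar>avg I \<phi>\<bar> + sqrt r"
      using subsolution_bounds(2)[OF p True, of "avg I \<phi>"] by linarith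
    then show ?thesis using True by (simp add: gap flip: r_def)
  qed (simp add: gap)
qed

lemma subsol_gap_le_sqrt:
  assumes "0 < l" shows "subsol_gap u \<phi> m l n x \<le> sqrt l"
proof -
  have "sqrt (max 0 (residual_level \<phi> m l n x)) \<le> sqrt l"
    using assms residual_level_le[of \<phi> m l n x] by simp
  then show ?thesis using subsol_gap_bounds(2)[of \<phi> m l n x] by linarith
qed

context
  fixes \<phi> :: "real \<Rightarrow> real"
  assumes \<phi>: "integrable lebesgue \<phi>"
begin

text \<open>Multiplying by the length makes the estimate additive over the halves, so the main
  inequality at the top combines with the induction hypothesis on each half at level
  \<open>l - a\<^sup>2\<close>.\<close>

lemma subsolution_le_integral_add_gap:
  assumes "0 < l"
  shows "2 powi m * u (avg (dyadic_interval k m) \<phi>, exceed_ratio \<phi> l (dyadic_interval k m), l) \<le>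
    (LINT x:dyadic_interval k m|lebesgue. \<bar>\<phi> x\<bar>) +
    (LINT x:dyadic_interval k m|lebesgue. subsol_gap u \<phi> m l n x)"
  using assms
proof (induction n arbitrary: k m l)
  case 0
  let ?I = "dyadic_interval k m"
  define c where "c = u (avg ?I \<phi>, exceed_ratio \<phi> l ?I, l) - \<bar>avg ?I \<phi>\<bar>"
  have "(LINT x:?I|lebesgue. subsol_gap u \<phi> m l 0 x) = (LINT x:?I|lebesgue. c)"
    by (rule set_lebesgue_integral_cong) (use 0 in \<open>auto simp: subsol_gap_def Let_def c_def dyadic_cell_eq\<close>)
  also have "\<dots> = 2 powi m * c"
    by (subst set_integral_const) auto
  finally show ?case using abs_avg_le[OF \<phi>, of m k] by (simp add: c_def algebra_simps)
next
  case (Suc n)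
  let ?I = "dyadic_interval k m" and ?L = "dyadic_interval (2 * k) (m - 1)"
    and ?R = "dyadic_interval (2 * k + 1) (m - 1)"
  define a where "a = half_jump \<phi> ?I"
  define f where "f = avg ?I \<phi>"
  have avgs: "avg ?L \<phi> = f - a" "avg ?R \<phi> = f + a"
    using avg_halves[OF \<phi> a_def] by (simp_all add: f_def)
  have int: "integrable lebesgue (\<lambda>x. \<bar>\<phi> x\<bar>)" using \<phi> by simp
  note abs_split = set_integral_dyadic_halves[of k m "\<lambda>x. \<bar>\<phi> x\<bar>",
      OF set_integrable_dyadic_interval[OF int] set_integrable_dyadic_interval[OF int]]
  show ?case
  proof (cases "a\<^sup>2 < l")
    case False
    txt \<open>The square function has already reached the level on all of the interval; the obstacle
      condition takes the place of the main inequality, which would leave the domain.\<close>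
    have "sqrt l \<le> \<bar>a\<bar>" using False by (simp add: real_le_lsqrt real_sqrt_le_iff flip: real_sqrt_abs)
    then have "u (f, exceed_ratio \<phi> l ?I, l) \<le> max \<bar>f\<bar> \<bar>a\<bar>"
      using subsolution_bounds(2)[OF exceed_ratio_bounds[of \<phi> l k m] Suc.prems, of f] by linarith
    also have "\<dots> = (\<bar>avg ?L \<phi>\<bar> + \<bar>avg ?R \<phi>\<bar>) / 2"
      by (simp add: avgs max_abs_eq_half_sum)
    finally have "2 powi m * u (f, exceed_ratio \<phi> l ?I, l) \<le> 2 powi m * ((\<bar>avg ?L \<phi>\<bar> + \<bar>avg ?R \<phi>\<bar>) / 2)"
      by (rule mult_left_mono) simp
    also have "\<dots> = 2 powi (m - 1) * \<bar>avg ?L \<phi>\<bar> + 2 powi (m - 1) * \<bar>avg ?R \<phi>\<bar>"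
      by (simp add: powi_two_diff_one algebra_simps add_divide_distrib)
    also have "\<dots> \<le> (LINT x:?I|lebesgue. \<bar>\<phi> x\<bar>)"
      unfolding abs_split by (intro add_mono abs_avg_le \<phi>)
    \<comment> \<open>The gap is nonnegative, so its integral may be added to reach the common form
      of the claim.\<close>
    also have "\<dots> \<le> \<dots> + (LINT x:?I|lebesgue. subsol_gap u \<phi> m l (Suc n) x)"
      using subsol_gap_bounds(1) by (simp add: set_lebesgue_integral_def)
    finally show ?thesis by (simp add: f_def)
  next
    case True
    let ?l = "l - a\<^sup>2"
    define pL where "pL = exceed_ratio \<phi> ?l ?L"
    define pR where "pR = exceed_ratio \<phi> ?l ?R"
    have p: "exceed_ratio \<phi> l ?I = (pL + pR) / 2"
      using exceed_ratio_halves[OF a_def, of l] True by (simp add: pL_def pR_def)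
    have pb: "0 \<le> pL" "pL \<le> 1" "0 \<le> pR" "pR \<le> 1"
      by (simp_all add: pL_def pR_def exceed_ratio_bounds)
    \<comment> \<open>On a half, the gap of generation \<open>Suc n\<close> seen from the parent is
      that of generation \<open>n\<close> seen from the half, with the parent's jump already
      subtracted.\<close>
    have gap: "(LINT x:dyadic_interval k' (m - 1)|lebesgue. subsol_gap u \<phi> m l (Suc n) x) =
        (LINT x:dyadic_interval k' (m - 1)|lebesgue. subsol_gap u \<phi> (m - 1) ?l n x)"
      if "k' = 2 * k \<or> k' = 2 * k + 1" for k'
    proof (rule set_lebesgue_integral_cong; (intro allI impI)?)
      fix x assume "x \<in> dyadic_interval k' (m - 1)"
      then have "x \<in> ?I" using that dyadic_interval_halves(1)[of k m] by blast
      then show "subsol_gap u \<phi> m l (Suc n) x = subsol_gap u \<phi> (m - 1) ?l n x"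
        by (simp add: subsol_gap_Suc dyadic_cell_eq a_def)
    qed simp
    have gap_int: "set_integrable lebesgue (dyadic_interval k' (m - 1)) (subsol_gap u \<phi> m l (Suc n))"
      if "k' = 2 * k \<or> k' = 2 * k + 1" for k'
      by (rule set_integrable_subset[OF set_integrable_subsol_gap[of k m]])
        (use that dyadic_interval_halves(1)[of k m] in auto)
    \<comment> \<open>The choice \<open>b = (pR - pL) / 2\<close> makes \<open>p + b\<close> and
      \<open>p - b\<close> the ratios on the right and left halves, in step with the signs of
      \<open>a\<close>.\<close>
    have "u (f, (pL + pR) / 2, ?l + a\<^sup>2) \<le>
        (u (f + a, (pL + pR) / 2 + (pR - pL) / 2, ?l) + u (f - a, (pL + pR) / 2 - (pR - pL) / 2, ?l)) / 2"
      by (rule subsolution_main_ineq) (use pb True in \<open>auto simp: field_simps\<close>)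
    also have "(pL + pR) / 2 + (pR - pL) / 2 = pR" by (simp add: field_simps)
    also have "(pL + pR) / 2 - (pR - pL) / 2 = pL" by (simp add: field_simps)
    finally have "2 powi m * u (f, (pL + pR) / 2, l) \<le>
        2 powi m * ((u (f + a, pR, ?l) + u (f - a, pL, ?l)) / 2)"
      by (intro mult_left_mono) simp_all
    also have "\<dots> = 2 powi (m - 1) * u (f - a, pL, ?l) + 2 powi (m - 1) * u (f + a, pR, ?l)"
      by (simp add: powi_two_diff_one algebra_simps add_divide_distrib)
    also have "\<dots> \<le>
        ((LINT x:?L|lebesgue. \<bar>\<phi> x\<bar>) + (LINT x:?L|lebesgue. subsol_gap u \<phi> (m - 1) ?l n x)) +
        ((LINT x:?R|lebesgue. \<bar>\<phi> x\<bar>) + (LINT x:?R|lebesgue. subsol_gap u \<phi> (m - 1) ?l n x))"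
      using Suc.IH[of ?l "m - 1" "2 * k"] Suc.IH[of ?l "m - 1" "2 * k + 1"] True
      by (intro add_mono) (simp_all add: avgs pL_def pR_def)
    also have "\<dots> = (LINT x:?I|lebesgue. \<bar>\<phi> x\<bar>) + (LINT x:?I|lebesgue. subsol_gap u \<phi> m l (Suc n) x)"
      using set_integral_dyadic_halves[of k m "subsol_gap u \<phi> m l (Suc n)"] gap gap_int abs_split
      by simp
    finally show ?thesis by (simp add: f_def p)
  qed
qed

section \<open>Vanishing of the gap almost everywhere\<close>

lemma AE_subsol_gap_tendsto_0:
  assumes l: "0 < l"
  shows "AE x in lebesgue. x \<in> dyadic_interval k m \<longrightarrow> (\<lambda>n. subsol_gap u \<phi> m l n x) \<longlonglongrightarrow> 0"
proof -
  let ?J = "dyadic_interval k m"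
  \<comment> \<open>Differentiation is applied to \<open>\<phi>\<close> and to the indicator of this
    one set, which controls the \<open>p\<close> coordinate of all cells with positive residual
    level.\<close>
  define E where "E = {y \<in> ?J. square_fun2 ?J \<phi> y \<ge> ennreal l}"
  have E: "E \<in> lmeasurable" unfolding E_def by (rule lmeasurable_square_fun2_ge)
  then have "integrable lebesgue (indicator E :: real \<Rightarrow> real)"
    by (auto simp: fmeasurable_def)
  from AE_avg_dyadic_cell_tendsto[OF this, of m] AE_avg_dyadic_cell_tendsto[OF \<phi>, of m]
  show ?thesis
  proof (eventually_elim, intro impI)
    fix x
    assume limE: "(\<lambda>n. avg (dyadic_cell (m - int n) x) (indicator E)) \<longlonglongrightarrow> indicator E x"
      and lim\<phi>: "(\<lambda>n. avg (dyadic_cell (m - int n) x) \<phi>) \<longlonglongrightarrow> \<phi> x" and x: "x \<in> ?J"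
    define s where "s = (\<lambda>n. (half_jump \<phi> (dyadic_cell (m - int n) x))\<^sup>2)"
    have s0: "0 \<le> s n" for n by (simp add: s_def)
    define r where "r = (\<lambda>n. residual_level \<phi> m l n x)"
    have r: "r n = l - sum s {..<n}" for n by (simp add: r_def s_def residual_level_def)
    have S: "square_fun2 ?J \<phi> x = (\<Sum>n. ennreal (s n))"
      unfolding s_def by (rule square_fun2_eq_suminf[OF x])
    have rlim: "r \<longlonglongrightarrow> l - suminf s" if "summable s"
      unfolding r by (intro tendsto_diff tendsto_const summable_LIMSEQ that)
    show "(\<lambda>n. subsol_gap u \<phi> m l n x) \<longlonglongrightarrow> 0"
    proof (cases "x \<in> E")
      case True
      then have ge: "ennreal l \<le> (\<Sum>n. ennreal (s n))" by (simp add: E_def S)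
      show ?thesis
      proof (cases "\<forall>n. 0 < r n")
        case False
        then obtain N where "r N \<le> 0" by (auto simp: not_less)
        \<comment> \<open>Residual levels never increase, so once one of them is nonpositive the gap
          keeps its default value 0.\<close>
        have "subsol_gap u \<phi> m l n x = 0" if "n \<ge> N" for n
        proof -
          have "residual_level \<phi> m l n x \<le> 0"
            using residual_level_antimono[OF that, of \<phi> m l x] \<open>r N \<le> 0\<close> by (simp add: r_def)
          then show ?thesis by (simp add: subsol_gap_def Let_def)
        qed
        then have "\<forall>\<^sub>F n in sequentially. subsol_gap u \<phi> m l n x = 0"
          by (auto simp: eventually_sequentially)
        then show ?thesis by (rule tendsto_eventually)
      next
        txt \<open>The level is attained only in the limit, so the boundary \<^term>\<open>p = (0::real)\<close> is not
          approached here; the gap vanishes because it is at most \<^term>\<open>sqrt (r n)\<close>.\<close>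
        case pos: True
        then have le: "sum s {..<n} \<le> l" for n using r[of n] pos[rule_format, of n] by linarith
        then have sm: "summable s" by (intro summableI_nonneg_bounded s0)
        have "suminf s \<le> l" using sm le by (rule suminf_le_const)
        moreover have "l \<le> suminf s"
          using ge suminf_ennreal2[OF s0 sm] suminf_nonneg[OF sm s0] by (simp add: ennreal_le_iff)
        ultimately have "r \<longlonglongrightarrow> 0" using rlim[OF sm] by simp
        then have "(\<lambda>n. sqrt (max 0 (r n))) \<longlonglongrightarrow> sqrt (max 0 0)"
          by (intro tendsto_intros)
        then have "(\<lambda>n. sqrt (max 0 (r n))) \<longlonglongrightarrow> 0" by simp
        then show ?thesis
          by (rule tendsto_sandwich[rotated 3, OF _ _ _ tendsto_const])
            (simp_all add: r_def subsol_gap_bounds)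
      qed
    next
      case False
      \<comment> \<open>Outside \<open>E\<close> the series stays strictly below the level, so it
        converges and the residual levels have a positive limit \<open>R\<close>. The limit point
        thus lies in \<open>Omega_L\<close>, where \<open>u\<close> is continuous.\<close>
      then have lt: "(\<Sum>n. ennreal (s n)) < ennreal l" using x by (simp add: E_def S)
      then have "(\<Sum>n. ennreal (s n)) \<noteq> top" by auto
      then have sm: "summable s" by (intro summable_suminf_not_top s0)
      define R where "R = l - suminf s"
      have R: "0 < R"
        using lt suminf_ennreal2[OF s0 sm] suminf_nonneg[OF sm s0] by (simp add: R_def ennreal_less_iff)
      have rpos: "0 < r n" for n
        using sum_le_suminf[OF sm, of "{..<n}"] s0 R by (simp add: r R_def)
      \<comment> \<open>The threshold \<open>r n\<close> changes with the cell, but by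
        \<open>square_fun2_ge_residual_iff\<close> the set being measured is always the part of
        \<open>E\<close> in the cell.\<close>
      have ratio: "exceed_ratio \<phi> (r n) (dyadic_cell (m - int n) x) =
          avg (dyadic_cell (m - int n) x) (indicator E)" for n
      proof -
        let ?I = "dyadic_cell (m - int n) x"
        have "?I \<subseteq> ?J" using dyadic_cell_diff_subset[of m n x] dyadic_cell_eq[OF x] by simp
        then have "{y \<in> ?I. ennreal (r n) \<le> square_fun2 ?I \<phi> y} = ?I \<inter> E"
          using square_fun2_ge_residual_iff[OF x, of \<phi> l n] rpos[of n] by (auto simp: E_def r_def)
        moreover have "(LINT y:?I|lebesgue. indicator E y) = measure lebesgue (?I \<inter> E)"
          unfolding set_lebesgue_integral_def
          using E by (simp flip: indicator_inter_arith add: dyadic_cell_def fmeasurable_def)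
        ultimately show ?thesis by (simp add: exceed_ratio_def avg_def)
      qed
      \<comment> \<open>The density of \<open>E\<close> tends to \<open>indicator E x\<close>, which
        is 0 here, so the limit lies on the face where the boundary condition gives the value of
        \<open>u\<close>.\<close>
      have "(\<lambda>n. (avg (dyadic_cell (m - int n) x) \<phi>,
          exceed_ratio \<phi> (r n) (dyadic_cell (m - int n) x), r n)) \<longlonglongrightarrow> (\<phi> x, 0, R)"
        using limE lim\<phi> rlim[OF sm] False unfolding ratio R_def by (intro tendsto_Pair) simp_all
      moreover have "continuous_on Omega_L u" using sub by (simp add: subsolution_def)
      ultimately have "(\<lambda>n. u (avg (dyadic_cell (m - int n) x) \<phi>,
          exceed_ratio \<phi> (r n) (dyadic_cell (m - int n) x), r n)) \<longlonglongrightarrow> u (\<phi> x, 0, R)"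
        by (intro continuous_on_tendsto_compose[of Omega_L u] always_eventually)
          (use R rpos in \<open>auto simp: Omega_L_def dyadic_cell_def exceed_ratio_bounds\<close>)
      also have "u (\<phi> x, 0, R) = \<bar>\<phi> x\<bar>"
        using sub R by (simp add: subsolution_def Omega_L_def)
      finally have "(\<lambda>n. u (avg (dyadic_cell (m - int n) x) \<phi>,
          exceed_ratio \<phi> (r n) (dyadic_cell (m - int n) x), r n) - \<bar>avg (dyadic_cell (m - int n) x) \<phi>\<bar>)
          \<longlonglongrightarrow> \<bar>\<phi> x\<bar> - \<bar>\<phi> x\<bar>"
        by (intro tendsto_diff tendsto_rabs lim\<phi>)
      then show ?thesis using rpos by (simp add: subsol_gap_def Let_def r_def)
    qed
  qed
qed

text \<open>The iterated estimate has a left side independent of \<open>n\<close>; on the right, the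
  integral of the gap tends to 0.\<close>

lemma subsolution_le_avg_abs:
  assumes l: "0 < l"
  shows "u (avg (dyadic_interval k m) \<phi>, exceed_ratio \<phi> l (dyadic_interval k m), l) \<le>
    avg (dyadic_interval k m) (\<lambda>x. \<bar>\<phi> x\<bar>)"
proof -
  let ?J = "dyadic_interval k m"
  have "(\<lambda>n. LINT x|lebesgue. indicator ?J x *\<^sub>R subsol_gap u \<phi> m l n x) \<longlonglongrightarrow> integral\<^sup>L lebesgue (\<lambda>x::real. 0 :: real)"
  \<comment> \<open>The bound \<open>sqrt l\<close> is uniform in \<open>n\<close> and integrable
    over \<open>J\<close>, which has finite length.\<close>
  proof (rule integral_dominated_convergence[where w = "\<lambda>x. indicator ?J x * sqrt l"])
    show "(\<lambda>x. indicator ?J x *\<^sub>R subsol_gap u \<phi> m l n x) \<in> borel_measurable lebesgue" for n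
      using set_integrable_subsol_gap[of k m u \<phi> l n] unfolding set_integrable_def by blast
    show "AE x in lebesgue. (\<lambda>n. indicator ?J x *\<^sub>R subsol_gap u \<phi> m l n x) \<longlonglongrightarrow> 0"
      using AE_subsol_gap_tendsto_0[OF l, of k m] by eventually_elim (auto simp: indicator_def)
    show "AE x in lebesgue. norm (indicator ?J x *\<^sub>R subsol_gap u \<phi> m l n x) \<le> indicator ?J x * sqrt l" for n
      using subsol_gap_bounds(1)[of \<phi> m l n] subsol_gap_le_sqrt[OF l, of \<phi> m n] by (auto simp: indicator_def)
  qed auto
  then have "(\<lambda>n. (LINT x:?J|lebesgue. \<bar>\<phi> x\<bar>) + (LINT x:?J|lebesgue. subsol_gap u \<phi> m l n x))
      \<longlonglongrightarrow> (LINT x:?J|lebesgue. \<bar>\<phi> x\<bar>) + 0"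
    unfolding set_lebesgue_integral_def by (intro tendsto_add tendsto_const) simp
  then have "2 powi m * u (avg ?J \<phi>, exceed_ratio \<phi> l ?J, l) \<le> (LINT x:?J|lebesgue. \<bar>\<phi> x\<bar>) + 0"
    by (rule LIMSEQ_le_const) (use subsolution_le_integral_add_gap[OF l] in blast)
  then show ?thesis by (simp add: avg_def field_simps)
qed

end

end

section \<open>Passage to the infimum over admissible functions\<close>

theorem theorem2p5:
  fixes u :: "real \<times> real \<times> real \<Rightarrow> real" and J :: "real set"
  assumes "subsolution u" and "J \<in> dyadic"
  shows "\<forall>\<omega>\<in>Omega_L. ereal (u \<omega>) \<le> bellman_L J \<omega>"
proof
  fix \<omega> assume "\<omega> \<in> Omega_L"
  then obtain f p l where \<omega>: "\<omega> = (f, p, l)" and l: "0 < l" by (auto simp: Omega_L_def)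
  obtain k m where J: "J = dyadic_interval k m" using assms(2) by (auto simp: dyadic_iff)
  show "ereal (u \<omega>) \<le> bellman_L J \<omega>"
    unfolding bellman_L_def
  proof (rule INF_greatest)
    fix \<phi> assume "\<phi> \<in> admissible J \<omega>"
    \<comment> \<open>Admissibility prescribes exactly the coordinates at which the estimate for a
      single function evaluates \<open>u\<close>.\<close>
    then have \<phi>: "integrable lebesgue \<phi>" and fp: "avg J \<phi> = f" "exceed_ratio \<phi> l J = p"
      by (auto simp: admissible_def \<omega> exceed_ratio_def)
    show "ereal (u \<omega>) \<le> ereal (avg J (\<lambda>x. \<bar>\<phi> x\<bar>))"
      using subsolution_le_avg_abs[OF assms(1) \<phi> l, of k m] fp by (simp add: \<omega> J)
  qed
qed

end
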